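(* Let $q=1+16a^2$ be a prime power with $a$ a positive integer, $\gamma$ a primitive element of $\mathbb{F}_q$, $l=\frac{q-1}{4}$, and let $G$ be the group on $\mathbb{F}_q\times\mathbb{Z}_l$ with multiplication $(x,i)(y,j)=(x+\gamma^{4i}y,\ i+j)$. Let $S=\{-1+x: x\in D_2^4\}$ and $E=\{(x,i): x\in S,\ i\in\mathbb{Z}_l\}$. Then $\mathrm{Cay}(G,E)$ is a directed strongly regular graph with parameters $\left(\frac{q(q-1)}{4},\ \left(\frac{q-1}{4}\right)^2,\ \left(\frac{q-1}{8}\right)^2,\ \left(\frac{q-1}{8}\right)^2-\frac{q-1}{16},\ \left(\frac{q-1}{8}\right)^2\right)$.
   Context: The cyclotomic classes of order $e$ (for $e\mid q-1$) with respect to the primitive element $\gamma$ are $D_i^e=\gamma^i\langle\gamma^e\rangle$, $i=0,\dots,e-1$. The Cayley digraph $\mathrm{Cay}(G,E)$ has vertex set $G$ and an arc $g\to h$ iff $g^{-1}h\in E$. A directed strongly regular graph with parameters $(v,k,t,\lambda,\mu)$ is a digraph (no loops, no multiple arcs) on $v$ vertices whose adjacency matrix $A$ satisfies $A^2=tI+\lambda A+\mu(J-I-A)$ and $AJ=JA=kJ$. (The paper's printed set "$-1+D_2^2\cup\{0\}$" is a misprint; the class $D_2^4$ is what its proof and parameters use.) *)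

theory Defs
  imports "HOL-Algebra.Group" "HOL-Library.Cardinality"
begin

definition primitive_element :: "'a::{field,finite} \<Rightarrow> bool" where
  "primitive_element \<gamma> \<longleftrightarrow> \<gamma> \<noteq> 0 \<and> (\<forall>x. x \<noteq> 0 \<longrightarrow> (\<exists>k::nat. x = \<gamma> ^ k))"

definition cyclotomic_class :: "'a::{field,finite} \<Rightarrow> nat \<Rightarrow> nat \<Rightarrow> 'a set" where
  "cyclotomic_class \<gamma> e i = {\<gamma> ^ i * (\<gamma> ^ e) ^ k | k. True}"

definition semidirect_grp :: "'a::{field,finite} \<Rightarrow> nat \<Rightarrow> ('a \<times> nat) monoid" where
  "semidirect_grp \<gamma> l = \<lparr> carrier = UNIV \<times> {0..<l},
      mult = (\<lambda>(x,i) (y,j). (x + \<gamma> ^ (4 * i) * y, (i + j) mod l)),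
      one = (0, 0) \<rparr>"

definition cayley_arc :: "('g, 'b) monoid_scheme \<Rightarrow> 'g set \<Rightarrow> 'g \<Rightarrow> 'g \<Rightarrow> bool" where
  "cayley_arc G E g h \<longleftrightarrow> inv\<^bsub>G\<^esub> g \<otimes>\<^bsub>G\<^esub> h \<in> E"

text \<open>Directed strongly regular graph with parameters (v,k,t,lambda,mu) on vertex set V with
  arc relation A, stated entrywise: no loops; A J = J A = k J (all out- and in-degrees k);
  (A^2)_{xy} = t if x = y, lambda if x -> y, mu otherwise.\<close>
definition dsrg :: "'v set \<Rightarrow> ('v \<Rightarrow> 'v \<Rightarrow> bool) \<Rightarrow> nat \<Rightarrow> nat \<Rightarrow> nat \<Rightarrow> nat \<Rightarrow> nat \<Rightarrow> bool" where
  "dsrg V A v k t lam mu \<longleftrightarrow>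
     finite V \<and> card V = v \<and>
     (\<forall>x\<in>V. \<not> A x x) \<and>
     (\<forall>x\<in>V. card {y\<in>V. A x y} = k) \<and>
     (\<forall>y\<in>V. card {x\<in>V. A x y} = k) \<and>
     (\<forall>x\<in>V. \<forall>y\<in>V. card {z\<in>V. A x z \<and> A z y} =
         (if x = y then t else if A x y then lam else mu))"

end

theory Submission
  imports Defs "HOL-Number_Theory.Euler_Criterion" "HOL-Algebra.Sylow"
begin

text \<open>
  There is an arc from \<open>(x, i)\<close> to \<open>(y, j)\<close> iff \<open>(y - x) / \<gamma>\<^sup>4\<^sup>i \<in> S\<close>, so the theorem reduces to the
  claim that every quartic class \<open>D\<^sub>i\<close> contains exactly \<open>a\<^sup>2\<close> elements of \<open>S\<close>, i.e. that the
  cyclotomic numbers \<open>(i, 2)\<close> of order 4 are all equal. Their symmetries leave the two values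
  \<open>(0, 2)\<close> and \<open>(1, 2)\<close>, with sum \<open>2a\<^sup>2\<close>, and the Jacobi sum of a quartic and the quadratic character
  has real part \<open>R = 4 ((1, 2) - (0, 2)) - 1\<close>. Its norm is \<open>q = 1 + (4a)\<^sup>2\<close>, and it is not
  divisible by the characteristic \<open>p\<close>, since modulo a prime above \<open>p\<close> it is \<open>- binom(2l, l)\<close>,
  which is prime to \<open>p\<close>. As \<open>q\<close> has only one primitive representation as a sum of two squares,
  \<open>R\<^sup>2 \<in> {1, 16a\<^sup>2}\<close>, and \<open>R \<equiv> -1\<close> modulo 4 leaves only \<open>R = -1\<close>.
\<close>

section \<open>Number theory\<close>

lemma multiplicity_fact_Suc:
  fixes p :: nat
  assumes "prime p"
  shows "multiplicity p (fact (Suc n) :: nat)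
    = multiplicity p (Suc n) + multiplicity p (fact n :: nat)"
  using assms by (simp add: fact_Suc prime_elem_multiplicity_mult_distrib del: mult_Suc)

lemma multiplicity_fact_prime_mult_add:
  fixes p :: nat
  assumes "prime p" and "r < p"
  shows "multiplicity p (fact (p * n + r) :: nat) = multiplicity p (fact (p * n) :: nat)"
  using \<open>r < p\<close>
proof (induction r)
  case (Suc r)
  have "\<not> p dvd p * n + Suc r"
    using Suc.prems by (metis dvd_add_right_iff dvd_triv_left nat_dvd_not_less zero_less_Suc)
  then have "multiplicity p (Suc (p * n + r)) = 0"
    by (simp add: not_dvd_imp_multiplicity_0)
  then show ?case
    using multiplicity_fact_Suc[OF \<open>prime p\<close>, of "p * n + r"] Suc by simp
qed simp

lemma multiplicity_fact_prime_mult: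
  fixes p :: nat
  assumes "prime p"
  shows "multiplicity p (fact (p * n) :: nat) = n + multiplicity p (fact n :: nat)"
proof (induction n)
  case (Suc n)
  have "p > 0"
    using assms by (rule prime_gt_0_nat)
  then have "p * Suc n = Suc (p * n + (p - 1))"
    by simp
  then have "multiplicity p (fact (p * Suc n) :: nat)
      = multiplicity p (p * Suc n) + multiplicity p (fact (p * n + (p - 1)) :: nat)"
    using multiplicity_fact_Suc[OF assms, of "p * n + (p - 1)"] by (simp only:)
  also have "multiplicity p (fact (p * n + (p - 1)) :: nat) = n + multiplicity p (fact n :: nat)"
    using multiplicity_fact_prime_mult_add[OF assms, of "p - 1" n] \<open>p > 0\<close> Suc.IH by simp
  also have "multiplicity p (p * Suc n) = 1 + multiplicity p (Suc n)"
    using assms \<open>p > 0\<close>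
    by (simp add: prime_elem_multiplicity_mult_distrib multiplicity_self del: mult_Suc_right)
  finally show ?case
    by (simp add: multiplicity_fact_Suc[OF assms] del: fact_Suc)
qed simp

text \<open>All base-\<open>p\<close> digits of \<open>f\<close> equal \<open>(p - 1) / e\<close>, so adding up at most \<open>e\<close> copies of \<open>f\<close>
  produces no carry.\<close>
lemma multiplicity_fact_mult_repdigit:
  fixes p e f m j :: nat
  assumes "prime p" and "[p = 1] (mod e)" and "e * f + 1 = p ^ m" and "e > 0" and "j \<le> e"
  shows "multiplicity p (fact (j * f) :: nat) = j * multiplicity p (fact f :: nat)"
  using \<open>e * f + 1 = p ^ m\<close> \<open>j \<le> e\<close>
proof (induction m arbitrary: f j)
  case 0
  then show ?case using \<open>e > 0\<close> by simp
next
  case (Suc m)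
  have "p \<ge> 1"
    using prime_ge_1_nat[OF \<open>prime p\<close>] .
  then obtain d where p_eq: "p = d * e + 1"
    using \<open>[p = 1] (mod e)\<close> by (auto simp: cong_le_nat)
  have "[p ^ m = 1] (mod e)"
    using cong_pow[OF \<open>[p = 1] (mod e)\<close>, of m] by simp
  then obtain g where g: "e * g + 1 = p ^ m"
    using \<open>p \<ge> 1\<close> by (force simp: cong_le_nat mult.commute)
  have "e * f + 1 = p * (e * g + 1)"
    using Suc.prems g by simp
  then have "e * f = e * (p * g + d)"
    by (simp add: p_eq algebra_simps)
  then have f_eq: "f = p * g + d"
    using \<open>e > 0\<close> by simp
  have fact_copies: "multiplicity p (fact (i * f) :: nat) = i * (g + multiplicity p (fact g :: nat))"
    if "i \<le> e" for i
  proof -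
    have "i * d < p"
      using mult_right_mono[OF that, of d] p_eq by (simp only: mult.commute[of d e]) linarith
    moreover have "i * f = p * (i * g) + i * d"
      unfolding f_eq by (simp only: distrib_left mult.left_commute)
    ultimately have "multiplicity p (fact (i * f) :: nat)
        = i * g + multiplicity p (fact (i * g) :: nat)"
      using \<open>prime p\<close> by (simp only: multiplicity_fact_prime_mult_add multiplicity_fact_prime_mult)
    then show ?thesis
      using Suc.IH[OF g that] by (simp add: distrib_left)
  qed
  show ?case
    using fact_copies[OF \<open>j \<le> e\<close>] fact_copies[of 1] \<open>e > 0\<close> by simp
qed

lemma not_dvd_binomial_repdigit:
  fixes p e f m i j :: nat
  assumes "prime p" and "[p = 1] (mod e)" and "e * f + 1 = p ^ m" and "e > 0" and "i + j \<le> e"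
  shows "\<not> p dvd ((i + j) * f choose (i * f))"
proof -
  have multiplicity_fact: "multiplicity p (fact (k * f) :: nat) = k * multiplicity p (fact f :: nat)"
    if "k \<le> e" for k
    using multiplicity_fact_mult_repdigit[OF assms(1-4) that] .
  have "fact ((i + j) * f) = fact (i * f) * fact (j * f) * ((i + j) * f choose (i * f))"
    using binomial_fact_lemma[of "i * f" "(i + j) * f"] by (simp add: distrib_right)
  then have "multiplicity p ((i + j) * f choose (i * f)) = 0"
    using assms(1,5) multiplicity_fact[of "i + j"] multiplicity_fact[of i] multiplicity_fact[of j]
    by (simp add: prime_elem_multiplicity_mult_distrib distrib_right)
  then show ?thesis
    using \<open>prime p\<close> \<open>i + j \<le> e\<close> by (subst (asm) multiplicity_eq_zero_iff) auto
qed

lemma QuadRes_minus_one_imp_cong_1_mod_4: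
  assumes "prime p" and "2 < p" and "QuadRes (int p) (-1)"
  shows "[p = 1] (mod 4)"
proof -
  have "\<not> int p dvd 2"
    using \<open>2 < p\<close> by (auto dest: zdvd_imp_le)
  have "[Legendre (-1) (int p) = (-1) ^ ((p - 1) div 2)] (mod int p)"
    using assms(1,2) by (rule euler_criterion)
  moreover have "Legendre (-1) (int p) = 1"
    using assms by (auto simp: Legendre_def cong_0_iff)
  ultimately have "even ((p - 1) div 2)"
    using \<open>\<not> int p dvd 2\<close> by (cases "even ((p - 1) div 2)") (auto simp: cong_iff_dvd_diff)
  moreover have "odd p"
    using assms(1,2) by (simp add: prime_odd_nat)
  ultimately have "p mod 4 = 1"
    by presburger
  then show ?thesis
    by (simp add: cong_def)
qed

lemma sum_two_squares_eq_if_cross_mult_eq: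
  fixes a b c d N :: int
  assumes "a ^ 2 + b ^ 2 = N" and "c ^ 2 + d ^ 2 = N" and "N \<noteq> 0" and "(a * d) ^ 2 = (b * c) ^ 2"
  shows "a ^ 2 = c ^ 2"
proof -
  have "b ^ 2 = N - a ^ 2" "d ^ 2 = N - c ^ 2"
    using assms(1,2) by simp_all
  then have "a ^ 2 * (N - c ^ 2) = (N - a ^ 2) * c ^ 2"
    using assms(4) by (simp only: power_mult_distrib)
  then have "N * a ^ 2 = N * c ^ 2"
    by (simp add: algebra_simps)
  then show ?thesis
    using \<open>N \<noteq> 0\<close> by simp
qed

text \<open>In Gaussian integers, \<open>N\<close> divides the imaginary part of \<open>(a + \<i>b) (c + \<i>d)\<close>, an element of
  norm \<open>N\<^sup>2\<close>; hence that element is \<open>N\<close> times a unit.\<close>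
lemma sum_two_squares_eq_if_dvd:
  fixes a b c d N :: int
  assumes ab: "a ^ 2 + b ^ 2 = N" and cd: "c ^ 2 + d ^ 2 = N" and "N \<noteq> 0" and "N dvd a * d + b * c"
  shows "a ^ 2 = c ^ 2 \<or> a ^ 2 = d ^ 2"
proof -
  obtain k where k: "a * d + b * c = N * k"
    using \<open>N dvd a * d + b * c\<close> by blast
  have "(a * c - b * d) ^ 2 + (a * d + b * c) ^ 2 = (a ^ 2 + b ^ 2) * (c ^ 2 + d ^ 2)"
    by (simp add: power2_eq_square algebra_simps)
  then have norm: "(a * c - b * d) ^ 2 + N ^ 2 * k ^ 2 = N ^ 2"
    unfolding ab cd k power_mult_distrib by (simp add: power2_eq_square)
  then have "N ^ 2 * k ^ 2 \<le> N ^ 2 * 1"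
    using zero_le_power2[of "a * c - b * d"] by linarith
  then have "k ^ 2 \<le> 1"
    using \<open>N \<noteq> 0\<close> by (simp add: mult_le_cancel_left)
  then consider "k = 0" | "k ^ 2 = 1"
    using zero_less_power2[of k] by linarith
  then show ?thesis
  proof cases
    case 1
    then have "a * d = - (b * c)"
      using k by simp
    then have "(a * d) ^ 2 = (b * c) ^ 2"
      by simp
    then show ?thesis
      using sum_two_squares_eq_if_cross_mult_eq[OF ab cd] \<open>N \<noteq> 0\<close> by blast
  next
    case 2
    then have "(a * c) ^ 2 = (b * d) ^ 2"
      using norm by simp
    then show ?thesis
      using sum_two_squares_eq_if_cross_mult_eq[OF ab, of d c] cd \<open>N \<noteq> 0\<close> by (simp add: add.commute)
  qed
qed

lemma prime_power_dvd_mult_if_not_dvd_both: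
  fixes p x y :: "'a::factorial_semiring_gcd"
  assumes "prime p" and "p ^ m dvd x * y" and "\<not> (p dvd x \<and> p dvd y)"
  shows "p ^ m dvd x \<or> p ^ m dvd y"
proof -
  have "coprime (p ^ m) x \<or> coprime (p ^ m) y"
    using assms(1,3) by (metis coprime_power_left_iff prime_imp_coprime)
  then show ?thesis
    using assms(2) by (auto simp: coprime_dvd_mult_left_iff coprime_dvd_mult_right_iff)
qed

lemma primitive_sum_two_squares_unique:
  fixes a b c d :: int and p m :: nat
  assumes "prime p" and "odd p" and "m > 0"
    and ab: "a ^ 2 + b ^ 2 = int p ^ m" and "\<not> int p dvd a"
    and cd: "c ^ 2 + d ^ 2 = int p ^ m" and "\<not> int p dvd c"
  shows "a ^ 2 = c ^ 2 \<or> a ^ 2 = d ^ 2"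
proof -
  have prime: "prime (int p)"
    using \<open>prime p\<close> by simp
  have "\<not> int p dvd d"
  proof
    assume "int p dvd d"
    moreover have "int p dvd c ^ 2 + d ^ 2"
      using \<open>m > 0\<close> by (simp add: cd)
    ultimately have "int p dvd c ^ 2"
      by (simp add: dvd_add_left_iff power2_eq_square)
    then show False
      using prime \<open>\<not> int p dvd c\<close> by (simp add: prime_dvd_power_iff)
  qed
  have "\<not> (int p dvd a * d + b * c \<and> int p dvd a * d - b * c)"
  proof
    assume "int p dvd a * d + b * c \<and> int p dvd a * d - b * c"
    then have "int p dvd (a * d + b * c) + (a * d - b * c)"
      by (blast intro: dvd_add)
    then have "int p dvd int 2"
      using prime \<open>\<not> int p dvd a\<close> \<open>\<not> int p dvd d\<close> by (simp add: prime_dvd_mult_iff)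
    then show False
      using primes_dvd_imp_eq[OF \<open>prime p\<close> two_is_prime_nat] \<open>odd p\<close> by (simp only: int_dvd_int_iff)
  qed
  moreover have "(a * d + b * c) * (a * d - b * c) = (c ^ 2 + d ^ 2) * a ^ 2 - (a ^ 2 + b ^ 2) * c ^ 2"
    by (simp add: power2_eq_square algebra_simps)
  then have "int p ^ m dvd (a * d + b * c) * (a * d - b * c)"
    by (simp add: ab cd)
  ultimately have "int p ^ m dvd a * d + b * c \<or> int p ^ m dvd a * d + (- b) * c"
    using prime_power_dvd_mult_if_not_dvd_both[OF prime, of m "a * d + b * c" "a * d - b * c"]
    by simp
  moreover have "int p ^ m \<noteq> 0"
    using prime by auto
  moreover have "a ^ 2 + (- b) ^ 2 = int p ^ m"
    using ab by simp
  ultimately show ?thesis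
    using sum_two_squares_eq_if_dvd ab cd by blast
qed

section \<open>The order of a finite field\<close>

lemma (in group) prime_dvd_order_imp_exists_pow_eq_one:
  assumes "finite (carrier G)" and "prime p" and "p dvd order G"
  shows "\<exists>x\<in>carrier G. x \<noteq> \<one> \<and> x [^] p = \<one>"
proof -
  obtain k where "order G = p ^ 1 * k"
    using \<open>p dvd order G\<close> by auto
  then obtain H where H: "subgroup H G" "card H = p"
    using sylow_thm[OF \<open>prime p\<close> is_group] assms(1) by fastforce
  interpret H: group "G\<lparr>carrier := H\<rparr>"
    using H(1) is_group by (rule subgroup.subgroup_is_group)
  have "H \<noteq> {\<one>}"
    using H(2) \<open>prime p\<close> by auto
  then obtain x where x: "x \<in> H" "x \<noteq> \<one>"
    using subgroup.one_closed[OF H(1)] by blast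
  moreover have "x [^] p = \<one>"
    using H.pow_order_eq_1[of x] x(1) H(2) by (simp add: order_def nat_pow_consistent[symmetric])
  ultimately show ?thesis
    using subgroup.mem_carrier[OF H(1)] by blast
qed

lemma (in group) order_eq_power_if_prime_exponent:
  assumes "finite (carrier G)" and "prime p" and exponent: "\<And>x. x \<in> carrier G \<Longrightarrow> x [^] p = \<one>"
  shows "\<exists>m. order G = p ^ m"
proof -
  have prime_factor_eq: "r = p" if "r \<in> prime_factors (order G)" for r
  proof -
    have "prime r" "r dvd order G"
      using that by auto
    then obtain x where x: "x \<in> carrier G" "x \<noteq> \<one>" "x [^] r = \<one>"
      using prime_dvd_order_imp_exists_pow_eq_one[OF assms(1)] by blast
    then have "ord x dvd r" "ord x dvd p" "ord x \<noteq> 1"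
      using exponent[OF x(1)] by (auto simp: pow_eq_id ord_eq_1[simplified])
    then show ?thesis
      using \<open>prime r\<close> \<open>prime p\<close> by (metis prime_nat_iff)
  qed
  have "order G = (\<Prod>r\<in>prime_factors (order G). r ^ multiplicity r (order G))"
    using assms(1) by (intro prime_factorization_nat) (simp add: order_gt_0_iff_finite)
  also have "\<dots> = (\<Prod>r\<in>{p}. r ^ multiplicity r (order G))"
    using prime_factor_eq \<open>prime p\<close>
    by (intro prod.mono_neutral_left) (auto simp: prime_factors_multiplicity)
  finally have "order G = p ^ multiplicity p (order G)"
    by simp
  then show ?thesis ..
qed

lemma prime_CHAR_finite_field: "prime CHAR('a::{field,finite})"
  by (intro prime_CHAR_semidom finite_imp_CHAR_pos finite)

lemma CARD_eq_CHAR_power: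
  obtains m where "CARD('a::{field,finite}) = CHAR('a) ^ m"
proof -
  define G :: "'a monoid" where "G = \<lparr>carrier = UNIV, monoid.mult = (+), one = 0\<rparr>"
  interpret G: group G
  proof (rule groupI)
    show "\<exists>y\<in>carrier G. y \<otimes>\<^bsub>G\<^esub> x = \<one>\<^bsub>G\<^esub>" for x
      by (rule bexI[of _ "- x"]) (simp_all add: G_def)
  qed (simp_all add: G_def add.assoc)
  have pow_eq: "x [^]\<^bsub>G\<^esub> n = of_nat n * x" for x :: 'a and n :: nat
  proof (induction n)
    case 0
    show ?case using G.nat_pow_0[of x] by (simp add: G_def)
  next
    case (Suc n)
    then show ?case using G.nat_pow_Suc[of x n] by (simp add: G_def algebra_simps)
  qed
  have "x [^]\<^bsub>G\<^esub> CHAR('a) = \<one>\<^bsub>G\<^esub>" for x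
    by (simp add: pow_eq) (simp add: G_def)
  moreover have "finite (carrier G)"
    by (simp add: G_def)
  ultimately have "\<exists>m. order G = CHAR('a) ^ m"
    using prime_CHAR_finite_field by (intro G.order_eq_power_if_prime_exponent)
  then show ?thesis
    using that by (auto simp: order_def G_def)
qed

lemma of_nat_CARD_eq_0: "of_nat CARD('a) = (0 :: 'a::{ring_1,finite})"
  using CHAR_dvd_CARD of_nat_eq_0_iff_char_dvd by blast

section \<open>Multiplicative characters and Jacobi sums\<close>

locale multiplicative_character =
  fixes \<chi> :: "'a::{field,finite} \<Rightarrow> 'b::idom"
  assumes zero [simp]: "\<chi> 0 = 0"
    and one [simp]: "\<chi> 1 = 1"
    and mult: "\<chi> (x * y) = \<chi> x * \<chi> y"
begin

lemma mult_inverse: "x \<noteq> 0 \<Longrightarrow> \<chi> x * \<chi> (inverse x) = 1"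
  by (simp flip: mult)

end

locale nontrivial_character = multiplicative_character +
  assumes nontrivial: "\<exists>u. u \<noteq> 0 \<and> \<chi> u \<noteq> 1"

lemma (in nontrivial_character) sum_eq_0: "(\<Sum>x\<in>UNIV. \<chi> x) = 0"
proof -
  obtain u where u: "u \<noteq> 0" "\<chi> u \<noteq> 1"
    using nontrivial by blast
  have "bij (\<lambda>x. u * x)"
    using u(1) by (intro bij_betw_byWitness[where f' = "\<lambda>x. x / u"]) auto
  then have "(\<Sum>x\<in>UNIV. \<chi> x) = (\<Sum>x\<in>UNIV. \<chi> (u * x))"
    by (rule sum.reindex_bij_betw[symmetric])
  also have "\<dots> = \<chi> u * (\<Sum>x\<in>UNIV. \<chi> x)"
    by (simp add: mult sum_distrib_left)
  finally show ?thesis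
    using u(2) by (metis mult_cancel_right1)
qed

lemma bij_betw_moebius:
  fixes z :: "'a::field"
  assumes "z \<noteq> 1"
  shows "bij_betw (\<lambda>y. (1 - z * y) / (1 - y)) (UNIV - {1}) (UNIV - {z})"
proof (rule bij_betw_byWitness[where f' = "\<lambda>w. (1 - w) / (z - w)"])
  show "\<forall>y\<in>UNIV - {1}. (1 - (1 - z * y) / (1 - y)) / (z - (1 - z * y) / (1 - y)) = y"
  proof
    fix y :: 'a
    assume "y \<in> UNIV - {1}"
    then have "1 - y \<noteq> 0"
      by simp
    then have "1 - (1 - z * y) / (1 - y) = y * (z - 1) / (1 - y)"
      and "z - (1 - z * y) / (1 - y) = (z - 1) / (1 - y)"
      by (simp_all add: field_simps)
    then show "(1 - (1 - z * y) / (1 - y)) / (z - (1 - z * y) / (1 - y)) = y"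
      using \<open>1 - y \<noteq> 0\<close> assms by simp
  qed
  show "\<forall>w\<in>UNIV - {z}. (1 - z * ((1 - w) / (z - w))) / (1 - (1 - w) / (z - w)) = w"
  proof
    fix w :: 'a
    assume "w \<in> UNIV - {z}"
    then have "z - w \<noteq> 0"
      by simp
    then have "1 - z * ((1 - w) / (z - w)) = w * (z - 1) / (z - w)"
      and "1 - (1 - w) / (z - w) = (z - 1) / (z - w)"
      by (simp_all add: field_simps)
    then show "(1 - z * ((1 - w) / (z - w))) / (1 - (1 - w) / (z - w)) = w"
      using \<open>z - w \<noteq> 0\<close> assms by simp
  qed
  show "(\<lambda>y. (1 - z * y) / (1 - y)) ` (UNIV - {1}) \<subseteq> UNIV - {z}"
    using assms by (auto simp: divide_eq_eq algebra_simps)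
  show "(\<lambda>w. (1 - w) / (z - w)) ` (UNIV - {z}) \<subseteq> UNIV - {1}"
    using assms by (auto simp: divide_eq_eq)
qed

lemma (in nontrivial_character) sum_moebius:
  "(\<Sum>y\<in>UNIV - {0}. \<chi> ((1 - z * y) / (1 - y))) = (if z = 1 then of_nat CARD('a) else 0) - \<chi> z - 1"
proof (cases "z = 1")
  case True
  have "(\<Sum>y\<in>UNIV - {0}. \<chi> ((1 - y) / (1 - y))) = (\<Sum>y\<in>UNIV - {0, 1 :: 'a}. 1)"
    by (intro sum.mono_neutral_cong_right) auto
  also have "\<dots> = of_nat (CARD('a) - 2)"
    by (simp add: card_Diff_subset numeral_2_eq_2)
  also have "\<dots> = of_nat CARD('a) - 2"
    using card_mono[of UNIV "{0, 1 :: 'a}"] by (simp add: of_nat_diff)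
  finally show ?thesis
    using True by simp
next
  case False
  have "(\<Sum>y\<in>UNIV - {1}. \<chi> ((1 - z * y) / (1 - y))) = (\<Sum>w\<in>UNIV - {z}. \<chi> w)"
    using bij_betw_moebius[OF False] by (rule sum.reindex_bij_betw)
  also have "\<dots> = - \<chi> z"
    by (simp add: sum_diff1 sum_eq_0)
  finally have "(\<Sum>y\<in>UNIV. \<chi> ((1 - z * y) / (1 - y))) = - \<chi> z"
    by (simp add: sum_diff1)
  then show ?thesis
    using False by (simp add: sum_diff1)
qed

definition jacobi_sum :: "('a::{field,finite} \<Rightarrow> 'b::idom) \<Rightarrow> ('a \<Rightarrow> 'b) \<Rightarrow> 'b" where
  "jacobi_sum \<chi> \<psi> = (\<Sum>x\<in>UNIV. \<chi> x * \<psi> (1 - x))"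

lemma jacobi_sum_mult_inverse_expand:
  fixes \<chi> \<psi> :: "'a::{field,finite} \<Rightarrow> 'b::idom"
  assumes "multiplicative_character \<chi>" and "multiplicative_character \<psi>"
  shows "jacobi_sum \<chi> \<psi> * jacobi_sum (\<lambda>x. \<chi> (inverse x)) (\<lambda>x. \<psi> (inverse x))
    = (\<Sum>z\<in>UNIV. \<chi> z * (\<Sum>y\<in>UNIV - {0}. \<psi> ((1 - z * y) / (1 - y))))"
proof -
  interpret \<chi>: multiplicative_character \<chi> by fact
  interpret \<psi>: multiplicative_character \<psi> by fact
  have "jacobi_sum \<chi> \<psi> * jacobi_sum (\<lambda>x. \<chi> (inverse x)) (\<lambda>x. \<psi> (inverse x))
      = (\<Sum>x\<in>UNIV. \<Sum>y\<in>UNIV. \<chi> (x / y) * \<psi> ((1 - x) / (1 - y)))"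
    unfolding jacobi_sum_def sum_product divide_inverse
    by (simp add: \<chi>.mult \<psi>.mult mult_ac)
  also have "\<dots> = (\<Sum>y\<in>UNIV. \<Sum>x\<in>UNIV. \<chi> (x / y) * \<psi> ((1 - x) / (1 - y)))"
    by (rule sum.swap)
  also have "\<dots> = (\<Sum>y\<in>UNIV - {0}. \<Sum>x\<in>UNIV. \<chi> (x / y) * \<psi> ((1 - x) / (1 - y)))"
    by (intro sum.mono_neutral_right) auto
  also have "\<dots> = (\<Sum>y\<in>UNIV - {0}. \<Sum>z\<in>UNIV. \<chi> z * \<psi> ((1 - z * y) / (1 - y)))"
  proof (rule sum.cong[OF refl])
    fix y :: 'a
    assume "y \<in> UNIV - {0}"
    then have "bij (\<lambda>z. z * y)"
      by (intro bij_betw_byWitness[where f' = "\<lambda>z. z / y"]) auto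
    then show "(\<Sum>x\<in>UNIV. \<chi> (x / y) * \<psi> ((1 - x) / (1 - y)))
        = (\<Sum>z\<in>UNIV. \<chi> z * \<psi> ((1 - z * y) / (1 - y)))"
      using \<open>y \<in> UNIV - {0}\<close> by (subst sum.reindex_bij_betw[symmetric]) auto
  qed
  also have "\<dots> = (\<Sum>z\<in>UNIV. \<chi> z * (\<Sum>y\<in>UNIV - {0}. \<psi> ((1 - z * y) / (1 - y))))"
    by (subst sum.swap) (simp add: sum_distrib_left)
  finally show ?thesis .
qed

theorem jacobi_sum_mult_inverse:
  fixes \<chi> \<psi> :: "'a::{field,finite} \<Rightarrow> 'b::idom"
  assumes "nontrivial_character \<chi>" and "nontrivial_character \<psi>"
    and "nontrivial_character (\<lambda>x. \<chi> x * \<psi> x)"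
  shows "jacobi_sum \<chi> \<psi> * jacobi_sum (\<lambda>x. \<chi> (inverse x)) (\<lambda>x. \<psi> (inverse x)) = of_nat CARD('a)"
proof -
  interpret \<chi>: nontrivial_character \<chi> by fact
  interpret \<psi>: nontrivial_character \<psi> by fact
  interpret \<chi>\<psi>: nontrivial_character "\<lambda>x. \<chi> x * \<psi> x" by fact
  have "jacobi_sum \<chi> \<psi> * jacobi_sum (\<lambda>x. \<chi> (inverse x)) (\<lambda>x. \<psi> (inverse x))
      = (\<Sum>z\<in>UNIV. \<chi> z * ((if z = 1 then of_nat CARD('a) else 0) - \<psi> z - 1))"
    by (simp only: jacobi_sum_mult_inverse_expand[OF \<chi>.multiplicative_character_axioms
          \<psi>.multiplicative_character_axioms] \<psi>.sum_moebius)
  also have "\<dots> = (\<Sum>z\<in>UNIV. (if z = 1 then of_nat CARD('a) else 0) - \<chi> z * \<psi> z - \<chi> z)"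
    by (intro sum.cong) (simp_all add: right_diff_distrib)
  also have "\<dots> = of_nat CARD('a)"
    by (simp add: sum_subtractf \<chi>.sum_eq_0 \<chi>\<psi>.sum_eq_0)
  finally show ?thesis .
qed

section \<open>Discrete logarithms and power characters\<close>

lemma power_eq_if_cong:
  fixes c :: "'b::monoid_mult"
  assumes "c ^ n = 1" and "[j = k] (mod n)"
  shows "c ^ j = c ^ k"
proof -
  have "c ^ i = c ^ (i mod n)" for i
    using assms(1) by (metis mult_div_mod_eq mult_1 power_add power_mult power_one)
  then show ?thesis
    using assms(2) by (metis cong_def)
qed

text \<open>The sort \<open>{field,finite}\<close> is not below the class \<open>finite_field\<close>, for which the library proves
  this as \<open>finite_field_power_card_eq_same\<close>.\<close>
lemma field_power_card_minus_1:
  fixes x :: "'a::{field,finite}"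
  assumes "x \<noteq> 0"
  shows "x ^ (CARD('a) - 1) = 1"
proof -
  have "(\<Prod>y\<in>UNIV - {0}. y) = (\<Prod>y\<in>UNIV - {0}. x * y)"
    by (rule prod.reindex_bij_witness[of _ "\<lambda>y. x * y" "\<lambda>y. y / x"]) (use assms in auto)
  also have "\<dots> = x ^ (CARD('a) - 1) * (\<Prod>y\<in>UNIV - {0}. y)"
    by (simp add: prod.distrib card_Diff_subset)
  finally show ?thesis
    by simp
qed

locale primitive_field_element =
  fixes \<gamma> :: "'a::{field,finite}"
  assumes primitive: "primitive_element \<gamma>"
begin

lemma gamma_nonzero [simp]: "\<gamma> \<noteq> 0"
  using primitive by (simp add: primitive_element_def)

lemma gamma_power_order: "\<gamma> ^ (CARD('a) - 1) = 1"
  by (rule field_power_card_minus_1) simp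

lemma card_gt_1: "CARD('a) > 1"
  using card_mono[of UNIV "{0, 1 :: 'a}"] by simp

lemma gamma_power_inj_on: "inj_on (\<lambda>k. \<gamma> ^ k) {..<CARD('a) - 1}"
proof (rule eq_card_imp_inj_on)
  have "(\<lambda>k. \<gamma> ^ k) ` {..<CARD('a) - 1} = UNIV - {0}"
  proof (intro equalityI subsetI)
    fix x :: 'a
    assume "x \<in> UNIV - {0}"
    then obtain k where "x = \<gamma> ^ k"
      using primitive by (auto simp: primitive_element_def)
    also have "\<dots> = \<gamma> ^ (k mod (CARD('a) - 1))"
      using gamma_power_order by (rule power_eq_if_cong) (simp add: cong_def)
    finally show "x \<in> (\<lambda>k. \<gamma> ^ k) ` {..<CARD('a) - 1}"
      using card_gt_1 by simp
  qed auto
  then show "card ((\<lambda>k. \<gamma> ^ k) ` {..<CARD('a) - 1}) = card {..<CARD('a) - 1}"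
    by (simp add: card_Diff_subset)
qed simp

lemma gamma_power_eq_iff: "\<gamma> ^ j = \<gamma> ^ k \<longleftrightarrow> [j = k] (mod (CARD('a) - 1))"
proof
  let ?n = "CARD('a) - 1"
  assume "\<gamma> ^ j = \<gamma> ^ k"
  moreover have "\<gamma> ^ i = \<gamma> ^ (i mod ?n)" for i
    using gamma_power_order by (rule power_eq_if_cong) (simp add: cong_def)
  ultimately have "\<gamma> ^ (j mod ?n) = \<gamma> ^ (k mod ?n)"
    by metis
  then show "[j = k] (mod ?n)"
    using inj_onD[OF gamma_power_inj_on] card_gt_1 by (simp add: cong_def)
qed (rule power_eq_if_cong[OF gamma_power_order])

lemma gamma_power_half:
  assumes "CARD('a) - 1 = 2 * k"
  shows "\<gamma> ^ k = - 1"
proof -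
  have "(\<gamma> ^ k) ^ 2 = 1"
    using gamma_power_order unfolding assms by (simp add: mult.commute flip: power_mult)
  moreover have "\<gamma> ^ k \<noteq> \<gamma> ^ 0"
    unfolding gamma_power_eq_iff assms using assms card_gt_1 by (simp add: cong_def)
  ultimately show ?thesis
    by (simp add: power2_eq_1_iff)
qed

text \<open>The value \<open>dlog 0\<close> is junk.\<close>
definition dlog :: "'a \<Rightarrow> nat" where
  "dlog x = (LEAST k. \<gamma> ^ k = x)"

lemma gamma_power_dlog: "x \<noteq> 0 \<Longrightarrow> \<gamma> ^ dlog x = x"
  unfolding dlog_def using primitive by (metis (mono_tags, lifting) LeastI_ex primitive_element_def)

lemma dlog_gamma_power: "[dlog (\<gamma> ^ k) = k] (mod (CARD('a) - 1))"
  by (rule gamma_power_eq_iff[THEN iffD1]) (simp add: gamma_power_dlog)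

lemma dlog_mult: "x \<noteq> 0 \<Longrightarrow> y \<noteq> 0 \<Longrightarrow> [dlog (x * y) = dlog x + dlog y] (mod (CARD('a) - 1))"
  by (rule gamma_power_eq_iff[THEN iffD1]) (simp add: gamma_power_dlog power_add)

definition power_char :: "'b::idom \<Rightarrow> 'a \<Rightarrow> 'b" where
  "power_char c x = (if x = 0 then 0 else c ^ dlog x)"

lemma power_char_gamma_power: "c ^ (CARD('a) - 1) = 1 \<Longrightarrow> power_char c (\<gamma> ^ k) = c ^ k"
  using dlog_gamma_power by (auto simp: power_char_def intro: power_eq_if_cong)

lemma multiplicative_character_power_char:
  assumes "c ^ (CARD('a) - 1) = 1"
  shows "multiplicative_character (power_char c)"
proof
  show "power_char c 1 = 1"
    using power_char_gamma_power[OF assms, of 0] by simp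
  show "power_char c (x * y) = power_char c x * power_char c y" for x y
    using power_eq_if_cong[OF assms dlog_mult] by (auto simp: power_char_def power_add)
qed (simp add: power_char_def)

lemma nontrivial_character_power_char:
  assumes "c ^ (CARD('a) - 1) = 1" and "c \<noteq> 1"
  shows "nontrivial_character (power_char c)"
  using multiplicative_character_power_char[OF assms(1)]
    power_char_gamma_power[OF assms(1), of 1] assms(2)
  by (auto simp: nontrivial_character_def nontrivial_character_axioms_def intro!: exI[of _ \<gamma>])

lemma power_char_mult: "power_char c x * power_char d x = power_char (c * d) x"
  by (simp add: power_char_def power_mult_distrib)

lemma power_char_inverse:
  assumes "c ^ (CARD('a) - 1) = 1" and "c * d = 1"
  shows "power_char c (inverse x) = power_char d x"
proof (cases "x = 0")
  case False
  interpret multiplicative_character "power_char c"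
    using assms(1) by (rule multiplicative_character_power_char)
  have "power_char c x * power_char d x = power_char c x * power_char c (inverse x)"
    using False mult_inverse[OF False] by (simp only: power_char_mult assms(2)) (simp add: power_char_def)
  then show ?thesis
    using False assms(2) by (auto simp: power_char_def)
qed (simp add: power_char_def)

lemma power_char_gamma_power_eq_power:
  assumes "k > 0"
  shows "power_char (\<gamma> ^ k) x = x ^ k"
proof (cases "x = 0")
  case False
  then show ?thesis
    by (metis gamma_power_dlog mult.commute power_char_def power_mult)
qed (use assms in \<open>simp add: power_char_def\<close>)

lemma sum_powers:
  "(\<Sum>x\<in>UNIV. x ^ k) = (if k > 0 \<and> CARD('a) - 1 dvd k then - 1 else (0 :: 'a))"
proof -
  consider "k = 0" | "k > 0" "CARD('a) - 1 dvd k" | "k > 0" "\<not> CARD('a) - 1 dvd k"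
    by blast
  then show ?thesis
  proof cases
    case 1
    then show ?thesis by (simp add: of_nat_CARD_eq_0)
  next
    case 2
    have "x ^ k = 1" if "x \<noteq> 0" for x :: 'a
      using 2(2) field_power_card_minus_1[OF that] by (auto simp: power_mult)
    then have "(\<Sum>x\<in>UNIV. (x :: 'a) ^ k) = (\<Sum>x\<in>UNIV - {0 :: 'a}. 1)"
      using 2(1) by (intro sum.mono_neutral_cong_right) auto
    also have "\<dots> = of_nat (CARD('a) - 1)"
      by (simp add: card_Diff_subset)
    also have "\<dots> = of_nat CARD('a) - 1"
      using card_gt_1 by (simp add: of_nat_diff)
    finally show ?thesis
      using 2 by (simp add: of_nat_CARD_eq_0)
  next
    case 3
    have "\<gamma> ^ k \<noteq> 1"
      using gamma_power_eq_iff[of k 0] 3(2) by (simp add: cong_0_iff)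
    moreover have "(\<gamma> ^ k) ^ (CARD('a) - 1) = 1"
      by (rule field_power_card_minus_1) simp
    ultimately interpret nontrivial_character "power_char (\<gamma> ^ k)"
      by (intro nontrivial_character_power_char)
    show ?thesis
      using sum_eq_0 3 by (simp add: power_char_gamma_power_eq_power)
  qed
qed

lemma sum_powers_less_twice_order:
  assumes "0 < k" and "k < 2 * (CARD('a) - 1)"
  shows "(\<Sum>x\<in>UNIV. x ^ k) = (if k = CARD('a) - 1 then - 1 else (0 :: 'a))"
proof -
  have "CARD('a) - 1 dvd k \<longleftrightarrow> k = CARD('a) - 1"
  proof
    assume "CARD('a) - 1 dvd k"
    then obtain c where c: "k = (CARD('a) - 1) * c"
      by blast
    then have "0 < (CARD('a) - 1) * c" "(CARD('a) - 1) * c < (CARD('a) - 1) * 2"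
      using assms by linarith+
    then have "c = 1"
      by simp
    then show "k = CARD('a) - 1"
      using c by simp
  qed simp
  then show ?thesis
    unfolding sum_powers using \<open>0 < k\<close> by simp
qed

lemma sum_power_mult_one_minus_power:
  fixes m n :: nat
  assumes "0 < m" and "m \<le> CARD('a) - 1" and "m + n < 2 * (CARD('a) - 1)"
  shows "(\<Sum>x\<in>UNIV. x ^ m * (1 - x) ^ n)
    = - ((-1) ^ (CARD('a) - 1 - m) * of_nat (n choose (CARD('a) - 1 - m)) :: 'a)"
proof -
  let ?k = "CARD('a) - 1 - m"
  have "(\<Sum>x\<in>UNIV. x ^ m * (1 - x) ^ n)
      = (\<Sum>x\<in>UNIV. \<Sum>k\<le>n. (-1) ^ k * of_nat (n choose k) * x ^ (m + k) :: 'a)"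
  proof (rule sum.cong[OF refl])
    fix x :: 'a
    have "(1 - x) ^ n = (\<Sum>k\<le>n. of_nat (n choose k) * (- x) ^ k)"
      using binomial_ring[of "- x" 1 n] by simp
    then show "x ^ m * (1 - x) ^ n = (\<Sum>k\<le>n. (-1) ^ k * of_nat (n choose k) * x ^ (m + k))"
      by (simp add: sum_distrib_left power_add power_minus[of x] mult_ac)
  qed
  also have "\<dots> = (\<Sum>k\<le>n. (-1) ^ k * of_nat (n choose k) * (\<Sum>x\<in>UNIV. x ^ (m + k)))"
    by (subst sum.swap) (simp add: sum_distrib_left)
  also have "\<dots> = (\<Sum>k\<le>n. if k = ?k then - ((-1) ^ k * of_nat (n choose k)) else 0)"
  proof (intro sum.cong refl)
    fix k
    assume "k \<in> {..n}"
    then have "(\<Sum>x\<in>UNIV. x ^ (m + k)) = (if k = ?k then - 1 else (0 :: 'a))"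
      using assms by (subst sum_powers_less_twice_order) auto
    then show "(-1) ^ k * of_nat (n choose k) * (\<Sum>x\<in>UNIV. x ^ (m + k))
        = (if k = ?k then - ((-1) ^ k * of_nat (n choose k)) else (0 :: 'a))"
      by simp
  qed
  also have "\<dots> = - ((-1) ^ ?k * of_nat (n choose ?k))"
    by (simp add: sum.delta' binomial_eq_0)
  finally show ?thesis .
qed

end

section \<open>Cyclotomic numbers\<close>

locale cyclotomy = primitive_field_element \<gamma> for \<gamma> :: "'a::{field,finite}" +
  fixes e f :: nat
  assumes card_field: "CARD('a) = e * f + 1"
begin

abbreviation D :: "nat \<Rightarrow> 'a set" where
  "D \<equiv> cyclotomic_class \<gamma> e"

definition cyclotomic_number :: "nat \<Rightarrow> nat \<Rightarrow> nat" where
  "cyclotomic_number i j = card {x \<in> D i. x + 1 \<in> D j}"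

lemma e_pos: "e > 0" and f_pos: "f > 0"
  using card_gt_1 by (simp_all add: card_field)

lemma dlog_gamma_power_cong: "[dlog (\<gamma> ^ k) = k] (mod e)"
  using dlog_gamma_power[of k] by (simp add: card_field cong_modulus_mult_nat)

lemma dlog_mult_cong: "x \<noteq> 0 \<Longrightarrow> y \<noteq> 0 \<Longrightarrow> [dlog (x * y) = dlog x + dlog y] (mod e)"
  using dlog_mult[of x y] by (simp add: card_field cong_modulus_mult_nat)

lemma power_card_minus_1_eq_1:
  fixes c :: "'b::monoid_mult"
  assumes "c ^ e = 1"
  shows "c ^ (CARD('a) - 1) = 1"
  by (simp add: card_field power_mult assms)

lemma mem_cyclotomic_class_iff: "x \<in> D i \<longleftrightarrow> x \<noteq> 0 \<and> [dlog x = i] (mod e)"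
proof
  assume "x \<in> D i"
  then obtain k where "x = \<gamma> ^ (i + e * k)"
    by (auto simp: cyclotomic_class_def power_add power_mult)
  then show "x \<noteq> 0 \<and> [dlog x = i] (mod e)"
    using dlog_gamma_power_cong[of "i + e * k"] by (simp add: cong_def)
next
  assume x: "x \<noteq> 0 \<and> [dlog x = i] (mod e)"
  define n where "n = dlog x + i * (e * f)"
  have "\<gamma> ^ n = x"
    using x gamma_power_dlog gamma_power_eq_iff[of n "dlog x"] by (simp add: n_def card_field cong_def)
  have "[n = i] (mod e)"
    using x by (simp add: n_def cong_def mult.left_commute)
  moreover have "i \<le> n"
    using e_pos f_pos by (simp add: n_def trans_le_add2)
  ultimately obtain k where "n = k * e + i"
    by (auto simp: cong_le_nat)
  then have "x = \<gamma> ^ i * (\<gamma> ^ e) ^ k"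
    using \<open>\<gamma> ^ n = x\<close> by (simp add: power_add mult.commute flip: power_mult)
  then show "x \<in> D i"
    by (auto simp: cyclotomic_class_def)
qed

lemma one_mem_cyclotomic_class: "1 \<in> D 0"
  using dlog_gamma_power_cong[of 0] by (simp add: mem_cyclotomic_class_iff)

lemma cyclotomic_class_mult:
  assumes "x \<in> D i" and "y \<in> D j" and "[k = i + j] (mod e)"
  shows "x * y \<in> D k"
  using assms dlog_mult_cong[of x y] cong_add[of "dlog x" i e "dlog y" j]
  by (auto simp: mem_cyclotomic_class_iff intro: cong_trans cong_sym)

lemma cyclotomic_class_divide:
  assumes "x \<in> D i" and "y \<in> D j" and "[k + j = i] (mod e)"
  shows "x / y \<in> D k"
proof -
  have "y \<noteq> 0"
    using assms(2) by (simp add: mem_cyclotomic_class_iff)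
  then have "[dlog (x / y) + dlog y = i] (mod e)"
    using dlog_mult_cong[of "x / y" y] assms(1)
    by (auto simp: mem_cyclotomic_class_iff intro: cong_trans cong_sym)
  moreover have "[k + dlog y = i] (mod e)"
    using assms(2,3) cong_add[OF cong_refl, of "dlog y" j e k]
    by (auto simp: mem_cyclotomic_class_iff intro: cong_trans)
  ultimately have "[dlog (x / y) = k] (mod e)"
    by (metis cong_add_rcancel_nat cong_sym cong_trans)
  then show ?thesis
    using assms(1) \<open>y \<noteq> 0\<close> by (simp add: mem_cyclotomic_class_iff)
qed

lemma cyclotomic_class_eq_quotients:
  assumes "t \<in> D i"
  shows "D i = (\<lambda>k. t / \<gamma> ^ (e * k)) ` {0..<f}"
proof (intro equalityI subsetI)
  fix x
  assume "x \<in> D i"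
  then have "t / x \<in> D 0"
    using assms by (intro cyclotomic_class_divide) auto
  then obtain k where k: "t / x = \<gamma> ^ (e * k)"
    by (auto simp: cyclotomic_class_def power_mult)
  have "\<gamma> ^ (e * (k mod f)) = \<gamma> ^ (e * k)"
    by (simp only: gamma_power_eq_iff card_field cong_def mult_mod_right mod_mod_trivial
        add_diff_cancel_right')
  then have "x = t / \<gamma> ^ (e * (k mod f))"
    using assms by (simp add: mem_cyclotomic_class_iff flip: k)
  then show "x \<in> (\<lambda>k. t / \<gamma> ^ (e * k)) ` {0..<f}"
    using f_pos by auto
next
  fix x
  assume "x \<in> (\<lambda>k. t / \<gamma> ^ (e * k)) ` {0..<f}"
  then obtain k where "x = t / \<gamma> ^ (e * k)"
    by blast
  moreover have "\<gamma> ^ (e * k) \<in> D 0"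
    using dlog_gamma_power_cong[of "e * k"] by (simp add: mem_cyclotomic_class_iff cong_def)
  ultimately show "x \<in> D i"
    using assms by (auto intro: cyclotomic_class_divide)
qed

lemma bij_betw_cyclotomic_class:
  assumes "t \<in> D i"
  shows "bij_betw (\<lambda>k. t / \<gamma> ^ (e * k)) {0..<f} (D i)"
  unfolding cyclotomic_class_eq_quotients[OF assms]
proof (rule inj_on_imp_bij_betw, rule inj_onI)
  fix j k
  assume jk: "j \<in> {0..<f}" "k \<in> {0..<f}" "t / \<gamma> ^ (e * j) = t / \<gamma> ^ (e * k)"
  then have "\<gamma> ^ (e * j) = \<gamma> ^ (e * k)"
    using assms by (simp add: mem_cyclotomic_class_iff field_simps)
  then have "[e * j = e * k] (mod (e * f))"
    by (simp add: gamma_power_eq_iff card_field)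
  then show "j = k"
    using jk e_pos by (simp add: cong_def)
qed

lemma card_cyclotomic_class: "card (D i) = f"
proof -
  have "\<gamma> ^ i \<in> D i"
    using dlog_gamma_power_cong by (simp add: mem_cyclotomic_class_iff)
  from bij_betw_same_card[OF bij_betw_cyclotomic_class[OF this]] show ?thesis
    by simp
qed

lemma minus_one_mem_cyclotomic_class:
  assumes "even f"
  shows "- 1 \<in> D 0"
proof -
  obtain g where g: "f = 2 * g"
    using assms by blast
  then have "\<gamma> ^ (e * g) = - 1"
    by (intro gamma_power_half) (simp add: card_field)
  then show ?thesis
    using dlog_gamma_power_cong[of "e * g"] by (simp add: mem_cyclotomic_class_iff cong_def)
qed

lemma minus_mem_cyclotomic_class_iff:
  assumes "- 1 \<in> D 0"
  shows "- x \<in> D i \<longleftrightarrow> x \<in> D i"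
  using cyclotomic_class_mult[OF assms, of x i i] cyclotomic_class_mult[OF assms, of "- x" i i]
  by auto

lemma cyclotomic_number_commute:
  assumes "- 1 \<in> D 0"
  shows "cyclotomic_number i j = cyclotomic_number j i"
  unfolding cyclotomic_number_def
proof (rule bij_betw_same_card[of "\<lambda>x. - 1 - x"], rule bij_betw_byWitness[where f' = "\<lambda>x. - 1 - x"])
  note minus_iff = minus_mem_cyclotomic_class_iff[OF assms]
  have reflect_iff: "- 1 - x \<in> D k \<longleftrightarrow> x + 1 \<in> D k" for x k
  proof -
    have "- 1 - x = - (x + 1)"
      by simp
    then show ?thesis
      by (simp only: minus_iff)
  qed
  show "(\<lambda>x. - 1 - x) ` {x \<in> D i. x + 1 \<in> D j} \<subseteq> {x \<in> D j. x + 1 \<in> D i}"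
    and "(\<lambda>x. - 1 - x) ` {x \<in> D j. x + 1 \<in> D i} \<subseteq> {x \<in> D i. x + 1 \<in> D j}"
    by (auto simp: reflect_iff minus_iff)
qed auto

lemma cyclotomic_number_inverse:
  assumes i': "[i' + i = 0] (mod e)" and j': "[j' = i' + j] (mod e)"
  shows "cyclotomic_number i j = cyclotomic_number i' j'"
  unfolding cyclotomic_number_def
proof (rule bij_betw_same_card[of inverse], rule bij_betw_byWitness[where f' = inverse])
  have image_inverse: "inverse ` {x \<in> D k. x + 1 \<in> D m} \<subseteq> {x \<in> D k'. x + 1 \<in> D m'}"
    if "[k' + k = 0] (mod e)" and "[m' + k = m] (mod e)" for k m k' m'
  proof clarify
    fix x
    assume x: "x \<in> D k" "x + 1 \<in> D m"
    then have "inverse x + 1 = (x + 1) / x"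
      by (auto simp: mem_cyclotomic_class_iff field_simps)
    then show "inverse x \<in> D k' \<and> inverse x + 1 \<in> D m'"
      using cyclotomic_class_divide[OF one_mem_cyclotomic_class x(1) that(1)]
        cyclotomic_class_divide[OF x(2,1) that(2)] by (simp add: inverse_eq_divide)
  qed
  have "[j' + i = (i' + i) + j] (mod e)"
    using cong_add[OF j' cong_refl[of i]] by (simp add: ac_simps)
  also have "[(i' + i) + j = 0 + j] (mod e)"
    using i' by (intro cong_add cong_refl)
  finally have "[j' + i = j] (mod e)"
    by simp
  then show "inverse ` {x \<in> D i. x + 1 \<in> D j} \<subseteq> {x \<in> D i'. x + 1 \<in> D j'}"
    using i' by (intro image_inverse)
  show "inverse ` {x \<in> D i'. x + 1 \<in> D j'} \<subseteq> {x \<in> D i. x + 1 \<in> D j}"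
    using i' j' by (intro image_inverse) (simp_all add: add.commute cong_sym)
qed auto

lemma sum_cyclotomic_number:
  "(\<Sum>j<e. cyclotomic_number i j) = (if - 1 \<in> D i then f - 1 else f)"
proof -
  have class_fibre: "{x \<in> D i - {- 1}. dlog (x + 1) mod e = j} = {x \<in> D i. x + 1 \<in> D j}"
    if "j < e" for j
    using that by (auto simp: mem_cyclotomic_class_iff cong_def eq_neg_iff_add_eq_0)
  have "(\<Sum>j<e. cyclotomic_number i j) = (\<Sum>j<e. \<Sum>x\<in>{x \<in> D i - {- 1}. dlog (x + 1) mod e = j}. 1)"
    by (intro sum.cong refl) (simp only: class_fibre cyclotomic_number_def card_eq_sum lessThan_iff)
  also have "\<dots> = (\<Sum>x\<in>D i - {- 1}. 1)"
    using e_pos by (intro sum.group) auto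
  also have "\<dots> = (if - 1 \<in> D i then f - 1 else f)"
    by (simp add: card_Diff_singleton_if card_cyclotomic_class)
  finally show ?thesis .
qed

lemma power_char_eq_sum_of_bool:
  assumes "c ^ e = 1"
  shows "power_char c x = (\<Sum>i<e. c ^ i * of_bool (x \<in> D i))"
proof (cases "x = 0")
  case False
  have "power_char c x = c ^ (dlog x mod e)"
    using False power_eq_if_cong[OF assms, of "dlog x" "dlog x mod e"] by (simp add: power_char_def)
  also have "\<dots> = (\<Sum>i<e. if i = dlog x mod e then c ^ i else 0)"
    using e_pos by (simp add: sum.delta')
  also have "\<dots> = (\<Sum>i<e. c ^ i * of_bool (x \<in> D i))"
    using False by (intro sum.cong) (auto simp: mem_cyclotomic_class_iff cong_def)
  finally show ?thesis .
qed (simp add: power_char_def mem_cyclotomic_class_iff)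

lemma cyclotomic_number_eq_card_one_minus:
  assumes "- 1 \<in> D 0"
  shows "cyclotomic_number i j = card {x \<in> D i. 1 - x \<in> D j}"
  unfolding cyclotomic_number_def
proof (rule bij_betw_same_card[of uminus], rule bij_betw_byWitness[where f' = uminus])
  note minus_iff = minus_mem_cyclotomic_class_iff[OF assms]
  show "uminus ` {x \<in> D i. x + 1 \<in> D j} \<subseteq> {x \<in> D i. 1 - x \<in> D j}"
    by (auto simp: minus_iff add.commute[of 1])
  show "uminus ` {x \<in> D i. 1 - x \<in> D j} \<subseteq> {x \<in> D i. x + 1 \<in> D j}"
    by (auto simp: minus_iff)
qed auto

lemma jacobi_sum_power_char:
  fixes c d :: "'b::idom"
  assumes "c ^ e = 1" and "d ^ e = 1" and "- 1 \<in> D 0"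
  shows "jacobi_sum (power_char c) (power_char d)
    = (\<Sum>i<e. \<Sum>j<e. c ^ i * d ^ j * of_nat (cyclotomic_number i j))"
proof -
  have count: "(\<Sum>x\<in>UNIV. of_bool (x \<in> D i) * of_bool (1 - x \<in> D j))
      = (of_nat (cyclotomic_number i j) :: 'b)"
    for i j
    by (simp add: cyclotomic_number_eq_card_one_minus[OF assms(3)] Int_def flip: of_bool_conj)
  have "jacobi_sum (power_char c) (power_char d)
      = (\<Sum>x\<in>UNIV. \<Sum>i<e. \<Sum>j<e. c ^ i * d ^ j * (of_bool (x \<in> D i) * of_bool (1 - x \<in> D j)))"
    unfolding jacobi_sum_def power_char_eq_sum_of_bool[OF assms(1)]
      power_char_eq_sum_of_bool[OF assms(2)]
    by (simp only: sum_product mult_ac)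
  also have "\<dots> = (\<Sum>i<e. \<Sum>x\<in>UNIV. \<Sum>j<e. c ^ i * d ^ j * (of_bool (x \<in> D i) * of_bool (1 - x \<in> D j)))"
    by (rule sum.swap)
  also have "\<dots> = (\<Sum>i<e. \<Sum>j<e. \<Sum>x\<in>UNIV. c ^ i * d ^ j * (of_bool (x \<in> D i) * of_bool (1 - x \<in> D j)))"
    by (intro sum.cong refl sum.swap)
  also have "\<dots> = (\<Sum>i<e. \<Sum>j<e. c ^ i * d ^ j * of_nat (cyclotomic_number i j))"
    by (simp only: count flip: sum_distrib_left)
  finally show ?thesis .
qed

lemma card_quotients_add_one_mem:
  assumes "t \<in> D i"
  shows "card {k \<in> {0..<f}. t / \<gamma> ^ (e * k) + 1 \<in> D j} = cyclotomic_number i j"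
proof -
  have "bij_betw (\<lambda>k. t / \<gamma> ^ (e * k)) {k \<in> {0..<f}. t / \<gamma> ^ (e * k) + 1 \<in> D j}
      {x \<in> D i. x + 1 \<in> D j}"
    by (rule bij_betw_Collect[OF bij_betw_cyclotomic_class[OF assms]]) simp
  then show ?thesis
    unfolding cyclotomic_number_def by (rule bij_betw_same_card)
qed

end

section \<open>Cyclotomic numbers of order four\<close>

lemma sum_lessThan_4: "(\<Sum>i<4. g i) = g 0 + g 1 + g 2 + g (3 :: nat)"
  for g :: "nat \<Rightarrow> 'b::comm_monoid_add"
  by (simp add: eval_nat_numeral add.assoc)

locale quartic_cyclotomy = cyclotomy \<gamma> 4 f for \<gamma> :: "'a::{field,finite}" and f :: nat +
  assumes even_f: "even f"
begin

lemma minus_one_mem: "- 1 \<in> D 0"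
  using even_f by (rule minus_one_mem_cyclotomic_class)

lemma cyclotomic_number_symmetries:
  "cyclotomic_number 1 0 = cyclotomic_number 0 1" "cyclotomic_number 3 3 = cyclotomic_number 0 1"
  "cyclotomic_number 2 0 = cyclotomic_number 0 2" "cyclotomic_number 2 2 = cyclotomic_number 0 2"
  "cyclotomic_number 3 0 = cyclotomic_number 0 3" "cyclotomic_number 1 1 = cyclotomic_number 0 3"
  "cyclotomic_number 1 3 = cyclotomic_number 1 2" "cyclotomic_number 2 1 = cyclotomic_number 1 2"
  "cyclotomic_number 2 3 = cyclotomic_number 1 2" "cyclotomic_number 3 1 = cyclotomic_number 1 2"
  "cyclotomic_number 3 2 = cyclotomic_number 1 2"
proof -
  note commute = cyclotomic_number_commute[OF minus_one_mem]
  note inverse = cyclotomic_number_inverse[unfolded cong_def]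
  show symmetric_0: "cyclotomic_number 1 0 = cyclotomic_number 0 1"
      "cyclotomic_number 2 0 = cyclotomic_number 0 2" "cyclotomic_number 3 0 = cyclotomic_number 0 3"
    by (rule commute)+
  show "cyclotomic_number 3 3 = cyclotomic_number 0 1"
    using inverse[of 1 3 0 3] symmetric_0 by simp
  show "cyclotomic_number 2 2 = cyclotomic_number 0 2"
    using inverse[of 2 2 0 2] symmetric_0 by simp
  show "cyclotomic_number 1 1 = cyclotomic_number 0 3"
    using inverse[of 3 1 0 1] symmetric_0 by simp
  show symmetric_12: "cyclotomic_number 2 1 = cyclotomic_number 1 2"
    by (rule commute)
  show inverse_12: "cyclotomic_number 3 1 = cyclotomic_number 1 2"
    using inverse[of 3 1 1 2] by simp
  show "cyclotomic_number 1 3 = cyclotomic_number 1 2"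
    using commute[of 1 3] inverse_12 by simp
  show "cyclotomic_number 2 3 = cyclotomic_number 1 2"
    using inverse[of 2 2 3 1] symmetric_12 by simp
  then show "cyclotomic_number 3 2 = cyclotomic_number 1 2"
    using commute[of 3 2] by simp
qed

lemma cyclotomic_number_row_sums:
  "cyclotomic_number 0 0 + cyclotomic_number 0 1 + cyclotomic_number 0 2 + cyclotomic_number 0 3 + 1 = f"
  "cyclotomic_number 0 1 + cyclotomic_number 0 3 + 2 * cyclotomic_number 1 2 = f"
  "2 * (cyclotomic_number 0 2 + cyclotomic_number 1 2) = f"
proof -
  have "- 1 \<in> D i \<longleftrightarrow> [0 = i] (mod 4)" for i
    using minus_one_mem by (auto simp: mem_cyclotomic_class_iff intro: cong_trans cong_sym)
  then have row_sum: "cyclotomic_number i 0 + cyclotomic_number i 1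
        + cyclotomic_number i 2 + cyclotomic_number i 3
      = (if 4 dvd i then f - 1 else f)" for i
    using sum_cyclotomic_number[of i] by (simp add: sum_lessThan_4 cong_sym_eq[of 0] cong_0_iff)
  show "cyclotomic_number 0 0 + cyclotomic_number 0 1 + cyclotomic_number 0 2 + cyclotomic_number 0 3 + 1 = f"
    using row_sum[of 0] f_pos by simp
  show "cyclotomic_number 0 1 + cyclotomic_number 0 3 + 2 * cyclotomic_number 1 2 = f"
    using row_sum[of 1] by (simp add: cyclotomic_number_symmetries del: One_nat_def)
  show "2 * (cyclotomic_number 0 2 + cyclotomic_number 1 2) = f"
    using row_sum[of 2] by (simp add: cyclotomic_number_symmetries del: One_nat_def)
qed

definition jacobi_re :: int where
  "jacobi_re = 4 * (int (cyclotomic_number 1 2) - int (cyclotomic_number 0 2)) - 1"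

definition jacobi_im :: int where
  "jacobi_im = 2 * (int (cyclotomic_number 0 1) - int (cyclotomic_number 0 3))"

lemma jacobi_sum_quartic_quadratic:
  fixes c :: "'b::idom"
  assumes "c ^ 2 = - 1"
  shows "jacobi_sum (power_char c) (power_char (- 1)) = of_int jacobi_re + c * of_int jacobi_im"
proof -
  let ?n = cyclotomic_number
  let ?alternating = "\<lambda>i. int (?n i 0) - int (?n i 1) + int (?n i 2) - int (?n i 3)"
  have "c ^ 3 = - c" "c ^ 4 = 1"
    using assms power_mult[of c 2 2] by (simp_all add: power3_eq_cube power2_eq_square)
  have "jacobi_sum (power_char c) (power_char (- 1))
      = (\<Sum>i<4. c ^ i * of_int (?alternating i))"
    using \<open>c ^ 4 = 1\<close> minus_one_mem
    by (subst jacobi_sum_power_char) (simp_all add: sum_lessThan_4 algebra_simps)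
  also have "\<dots> = of_int (?alternating 0 - ?alternating 2) + c * of_int (?alternating 1 - ?alternating 3)"
    using assms \<open>c ^ 3 = - c\<close> by (simp add: sum_lessThan_4 algebra_simps)
  also have "?alternating 0 - ?alternating 2 = jacobi_re"
    using cyclotomic_number_row_sums
    by (simp add: jacobi_re_def cyclotomic_number_symmetries del: One_nat_def)
  also have "?alternating 1 - ?alternating 3 = jacobi_im"
    by (simp add: jacobi_im_def cyclotomic_number_symmetries del: One_nat_def)
  finally show ?thesis .
qed

lemma jacobi_sum_two_squares: "jacobi_re ^ 2 + jacobi_im ^ 2 = int CARD('a)"
proof -
  have order: "\<i> ^ (CARD('a) - 1) = 1" "(- 1 :: complex) ^ (CARD('a) - 1) = 1"
    by (rule power_card_minus_1_eq_1, simp)+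
  have nontrivial_product: "nontrivial_character (\<lambda>x. power_char \<i> x * power_char (- 1) x)"
    unfolding power_char_mult
    by (intro nontrivial_character_power_char power_card_minus_1_eq_1) (simp_all add: complex_eq_iff)
  have "jacobi_sum (power_char \<i>) (power_char (- 1))
        * jacobi_sum (\<lambda>x. power_char \<i> (inverse x)) (\<lambda>x. power_char (- 1) (inverse x))
      = of_nat CARD('a)"
    using nontrivial_product order
    by (intro jacobi_sum_mult_inverse nontrivial_character_power_char) (simp_all add: complex_eq_iff)
  also have "(\<lambda>x. power_char \<i> (inverse x)) = power_char (- \<i>)"
    using order by (intro ext power_char_inverse) simp_all
  also have "(\<lambda>x. power_char (- 1 :: complex) (inverse x)) = power_char (- 1)"
    using order by (intro ext power_char_inverse) simp_all
  finally have "of_int (jacobi_re ^ 2 + jacobi_im ^ 2) = (of_int (int CARD('a)) :: complex)"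
    by (simp add: jacobi_sum_quartic_quadratic power2_eq_square algebra_simps)
  then show ?thesis
    by (simp only: of_int_eq_iff)
qed

text \<open>Reduction modulo one of the two primes of \<open>\<int>[\<i>]\<close> above the characteristic; modulo the other
  one the Jacobi sum vanishes.\<close>
lemma jacobi_sum_reduction:
  "of_int jacobi_re + \<gamma> ^ (3 * f) * of_int jacobi_im = - (of_nat (2 * f choose f) :: 'a)"
proof -
  have "\<gamma> ^ (2 * f) = - 1"
    by (intro gamma_power_half) (simp add: card_field)
  moreover have "(\<gamma> ^ (3 * f)) ^ 2 = \<gamma> ^ (4 * f) * \<gamma> ^ (2 * f)"
    by (simp flip: power_mult power_add)
  ultimately have "(\<gamma> ^ (3 * f)) ^ 2 = - 1"
    using gamma_power_order by (simp add: card_field)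
  then have "of_int jacobi_re + \<gamma> ^ (3 * f) * of_int jacobi_im
      = jacobi_sum (power_char (\<gamma> ^ (3 * f))) (power_char (- 1))"
    by (rule jacobi_sum_quartic_quadratic[symmetric])
  also have "\<dots> = (\<Sum>x\<in>UNIV. x ^ (3 * f) * (1 - x) ^ (2 * f))"
    using f_pos
    by (simp add: jacobi_sum_def power_char_gamma_power_eq_power flip: \<open>\<gamma> ^ (2 * f) = - 1\<close>)
  also have "\<dots> = - ((-1) ^ f * of_nat (2 * f choose f))"
    using sum_power_mult_one_minus_power[of "3 * f" "2 * f"] f_pos by (simp add: card_field)
  finally show ?thesis
    using even_f by simp
qed

lemma CHAR_not_dvd_jacobi_re:
  assumes "[CHAR('a) = 1] (mod 4)"
  shows "\<not> int CHAR('a) dvd jacobi_re"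
proof
  assume re: "int CHAR('a) dvd jacobi_re"
  have "prime (int CHAR('a))"
    using prime_CHAR_finite_field by simp
  have "int CHAR('a) dvd jacobi_re ^ 2 + jacobi_im ^ 2"
    by (simp add: jacobi_sum_two_squares CHAR_dvd_CARD)
  then have "int CHAR('a) dvd jacobi_im ^ 2"
    using re by (simp add: dvd_add_right_iff power2_eq_square)
  then have "int CHAR('a) dvd jacobi_im"
    using \<open>prime (int CHAR('a))\<close> by (simp add: prime_dvd_power_iff)
  then have "of_nat (2 * f choose f) = (0 :: 'a)"
    using re jacobi_sum_reduction by (simp flip: of_int_eq_0_iff_char_dvd)
  then have "CHAR('a) dvd (2 * f choose f)"
    by (simp add: of_nat_eq_0_iff_char_dvd)
  moreover obtain m where "CARD('a) = CHAR('a) ^ m"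
    using CARD_eq_CHAR_power .
  then have "\<not> CHAR('a) dvd (2 * f choose f)"
    using not_dvd_binomial_repdigit[of "CHAR('a)" 4 f m 1 1] prime_CHAR_finite_field assms
    by (simp add: card_field flip: mult_2)
  ultimately show False
    by blast
qed

lemma odd_CHAR: "odd CHAR('a)"
proof
  assume "even CHAR('a)"
  then have "even CARD('a)"
    using CHAR_dvd_CARD dvd_trans by blast
  then show False
    by (simp add: card_field)
qed

lemma CHAR_cong_1_mod_4:
  assumes "f = 4 * a ^ 2"
  shows "[CHAR('a) = 1] (mod 4)"
proof (rule QuadRes_minus_one_imp_cong_1_mod_4)
  show "prime CHAR('a)"
    by (rule prime_CHAR_finite_field)
  then show "2 < CHAR('a)"
    using odd_CHAR prime_ge_2_nat[of "CHAR('a)"] by (cases "CHAR('a) = 2") auto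
  have "int CHAR('a) dvd int (4 * f + 1)"
    unfolding card_field[symmetric] using CHAR_dvd_CARD by (simp only: int_dvd_int_iff)
  then have "int CHAR('a) dvd (4 * int a) ^ 2 - - 1"
    by (simp add: assms power_mult_distrib add.commute)
  then show "QuadRes (int CHAR('a)) (- 1)"
    unfolding QuadRes_def cong_iff_dvd_diff ..
qed

lemma jacobi_re_eq_minus_one:
  assumes f_eq: "f = 4 * a ^ 2"
  shows "jacobi_re = - 1"
proof -
  obtain m where m: "CARD('a) = CHAR('a) ^ m"
    using CARD_eq_CHAR_power .
  have "m > 0"
    using m card_gt_1 by (cases m) auto
  have card_eq: "int CARD('a) = int CHAR('a) ^ m"
    using m by simp
  then have "1 ^ 2 + (4 * int a) ^ 2 = int CHAR('a) ^ m"
    by (simp add: card_field f_eq power_mult_distrib)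
  moreover have "jacobi_re ^ 2 + jacobi_im ^ 2 = int CHAR('a) ^ m"
    using jacobi_sum_two_squares card_eq by simp
  moreover have "\<not> int CHAR('a) dvd 1"
    by simp
  ultimately have "jacobi_re ^ 2 = 1 ^ 2 \<or> jacobi_re ^ 2 = (4 * int a) ^ 2"
    using primitive_sum_two_squares_unique[OF prime_CHAR_finite_field odd_CHAR \<open>m > 0\<close>]
      CHAR_not_dvd_jacobi_re[OF CHAR_cong_1_mod_4[OF f_eq]] by blast
  then have "jacobi_re \<in> {1, - 1, 4 * int a, - (4 * int a)}"
    by (simp only: power2_eq_iff) auto
  then show ?thesis
    unfolding jacobi_re_def by (elim insertE emptyE) presburger+
qed

theorem cyclotomic_number_2_eq:
  assumes "f = 4 * a ^ 2"
  shows "cyclotomic_number i 2 = a ^ 2"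
proof -
  have "cyclotomic_number 1 2 = cyclotomic_number 0 2"
    using jacobi_re_eq_minus_one[OF assms] by (simp add: jacobi_re_def)
  moreover have "cyclotomic_number i 2 = cyclotomic_number (i mod 4) 2"
    by (simp add: cyclotomic_number_def mem_cyclotomic_class_iff cong_def)
  moreover have "i mod 4 \<in> {0, 1, 2, 3}"
    by auto
  ultimately show ?thesis
    using cyclotomic_number_row_sums(3) cyclotomic_number_symmetries assms by auto
qed

end

section \<open>Cayley digraphs of the semidirect product\<close>

lemma card_affine_preimage:
  fixes S :: "'a::field set"
  assumes "c \<noteq> 0"
  shows "card {y. (y - x) / c \<in> S} = card S" and "card {x. (y - x) / c \<in> S} = card S"
proof -
  have "bij_betw (\<lambda>s. x + s * c) S {y. (y - x) / c \<in> S}"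
    using assms by (intro bij_betw_byWitness[where f' = "\<lambda>y. (y - x) / c"]) auto
  then show "card {y. (y - x) / c \<in> S} = card S"
    by (rule bij_betw_same_card[symmetric])
  have "bij_betw (\<lambda>s. y - s * c) S {x. (y - x) / c \<in> S}"
    using assms by (intro bij_betw_byWitness[where f' = "\<lambda>x. (y - x) / c"]) auto
  then show "card {x. (y - x) / c \<in> S} = card S"
    by (rule bij_betw_same_card[symmetric])
qed

locale semidirect_field =
  fixes \<gamma> :: "'a::{field,finite}" and l :: nat
  assumes l_pos: "l > 0" and root_of_unity: "\<gamma> ^ (4 * l) = 1"
begin

abbreviation \<Gamma> :: "('a \<times> nat) monoid" where
  "\<Gamma> \<equiv> semidirect_grp \<gamma> l"

abbreviation arc :: "'a set \<Rightarrow> 'a \<times> nat \<Rightarrow> 'a \<times> nat \<Rightarrow> bool" where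
  "arc S \<equiv> cayley_arc \<Gamma> (S \<times> {0..<l})"

lemma gamma_nonzero [simp]: "\<gamma> \<noteq> 0"
  using l_pos root_of_unity by (auto simp: power_0_left)

lemma gamma_power_4_mod: "\<gamma> ^ (4 * (k mod l)) = \<gamma> ^ (4 * k)"
  using root_of_unity by (rule power_eq_if_cong) (simp only: cong_def mult_mod_right mod_mod_trivial)

lemma carrier_semidirect_grp: "carrier \<Gamma> = UNIV \<times> {0..<l}"
  by (simp add: semidirect_grp_def)

lemma group_semidirect_grp: "group \<Gamma>"
proof (rule groupI)
  show "x \<otimes>\<^bsub>\<Gamma>\<^esub> y \<in> carrier \<Gamma>" for x y
    using l_pos by (auto simp: semidirect_grp_def split: prod.splits)
  show "x \<otimes>\<^bsub>\<Gamma>\<^esub> y \<otimes>\<^bsub>\<Gamma>\<^esub> z = x \<otimes>\<^bsub>\<Gamma>\<^esub> (y \<otimes>\<^bsub>\<Gamma>\<^esub> z)" for x y z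
    by (cases x; cases y; cases z)
       (simp add: semidirect_grp_def gamma_power_4_mod mod_add_left_eq mod_add_right_eq
          add.assoc distrib_left power_add mult.assoc)
  fix x
  assume "x \<in> carrier \<Gamma>"
  then obtain u i where x: "x = (u, i)" "i < l"
    by (auto simp: semidirect_grp_def)
  show "\<one>\<^bsub>\<Gamma>\<^esub> \<otimes>\<^bsub>\<Gamma>\<^esub> x = x"
    using x by (simp add: semidirect_grp_def)
  define k where "k = (l - i) mod l"
  have "(- (\<gamma> ^ (4 * k) * u), k) \<otimes>\<^bsub>\<Gamma>\<^esub> x = \<one>\<^bsub>\<Gamma>\<^esub>"
    using x by (simp add: semidirect_grp_def k_def mod_add_left_eq)
  moreover have "(- (\<gamma> ^ (4 * k) * u), k) \<in> carrier \<Gamma>"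
    using l_pos by (simp add: semidirect_grp_def k_def)
  ultimately show "\<exists>y\<in>carrier \<Gamma>. y \<otimes>\<^bsub>\<Gamma>\<^esub> x = \<one>\<^bsub>\<Gamma>\<^esub>" ..
qed (use l_pos in \<open>simp add: semidirect_grp_def\<close>)

lemma arc_iff:
  assumes "i < l" and "j < l"
  shows "arc S (x, i) (y, j) \<longleftrightarrow> (y - x) / \<gamma> ^ (4 * i) \<in> S"
proof -
  interpret group \<Gamma>
    by (rule group_semidirect_grp)
  have mem: "(x, i) \<in> carrier \<Gamma>" "(y, j) \<in> carrier \<Gamma>"
    using assms by (simp_all add: semidirect_grp_def)
  obtain u k where uk: "inv\<^bsub>\<Gamma>\<^esub> (x, i) \<otimes>\<^bsub>\<Gamma>\<^esub> (y, j) = (u, k)"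
    by fastforce
  have "(u, k) \<in> carrier \<Gamma>"
    using mem by (simp flip: uk)
  then have "k < l"
    by (simp add: semidirect_grp_def)
  have "(x, i) \<otimes>\<^bsub>\<Gamma>\<^esub> (u, k) = (y, j)"
    using mem by (simp flip: uk m_assoc)
  then have "x + \<gamma> ^ (4 * i) * u = y"
    by (simp add: semidirect_grp_def)
  then have "u = (y - x) / \<gamma> ^ (4 * i)"
    by (auto simp: field_simps)
  then show ?thesis
    using \<open>k < l\<close> by (simp add: cayley_arc_def uk)
qed

lemma card_out_neighbours:
  assumes "v \<in> carrier \<Gamma>"
  shows "card {w \<in> carrier \<Gamma>. arc S v w} = card S * l"
proof -
  obtain x i where v: "v = (x, i)" "i < l"
    using assms by (auto simp: carrier_semidirect_grp)
  have "{w \<in> carrier \<Gamma>. arc S v w} = {y. (y - x) / \<gamma> ^ (4 * i) \<in> S} \<times> {0..<l}"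
    using v by (auto simp: carrier_semidirect_grp arc_iff)
  then show ?thesis
    by (simp add: card_cartesian_product card_affine_preimage)
qed

lemma card_in_neighbours:
  assumes "w \<in> carrier \<Gamma>"
  shows "card {v \<in> carrier \<Gamma>. arc S v w} = card S * l"
proof -
  obtain y j where w: "w = (y, j)" "j < l"
    using assms by (auto simp: carrier_semidirect_grp)
  have "{v \<in> carrier \<Gamma>. arc S v w}
      = prod.swap ` (SIGMA i:{0..<l}. {x. (y - x) / \<gamma> ^ (4 * i) \<in> S})"
    using w by (force simp: carrier_semidirect_grp arc_iff image_iff)
  then show ?thesis
    by (simp add: card_image card_affine_preimage)
qed

lemma card_common_neighbours:
  assumes "v \<in> carrier \<Gamma>" and "w \<in> carrier \<Gamma>" and "0 \<notin> S"
    and quotients: "\<And>t. t \<noteq> 0 \<Longrightarrow> card {i \<in> {0..<l}. t / \<gamma> ^ (4 * i) \<in> S} = c"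
  shows "card {z \<in> carrier \<Gamma>. arc S v z \<and> arc S z w} = (if arc S v w then card S - 1 else card S) * c"
proof -
  obtain x i where v: "v = (x, i)" "i < l"
    using assms by (auto simp: carrier_semidirect_grp)
  obtain y j where w: "w = (y, j)" "j < l"
    using assms by (auto simp: carrier_semidirect_grp)
  define U where "U = {u. (u - x) / \<gamma> ^ (4 * i) \<in> S}"
  have "{z \<in> carrier \<Gamma>. arc S v z \<and> arc S z w}
      = (SIGMA u:U. {k \<in> {0..<l}. (y - u) / \<gamma> ^ (4 * k) \<in> S})"
    using v w by (auto simp: carrier_semidirect_grp arc_iff U_def)
  then have "card {z \<in> carrier \<Gamma>. arc S v z \<and> arc S z w}
      = (\<Sum>u\<in>U. card {k \<in> {0..<l}. (y - u) / \<gamma> ^ (4 * k) \<in> S})"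
    by simp
  also have "\<dots> = (\<Sum>u\<in>U - {y}. c)"
    using \<open>0 \<notin> S\<close> by (intro sum.mono_neutral_cong_right) (auto simp: quotients[simplified])
  also have "\<dots> = card (U - {y}) * c"
    by simp
  also have "card (U - {y}) = (if y \<in> U then card S - 1 else card S)"
    by (simp add: card_Diff_singleton_if U_def card_affine_preimage)
  also have "y \<in> U \<longleftrightarrow> arc S v w"
    using v w by (simp add: arc_iff U_def)
  finally show ?thesis .
qed

theorem dsrg_cayley_arc:
  assumes "0 \<notin> S" and "\<And>t. t \<noteq> 0 \<Longrightarrow> card {i \<in> {0..<l}. t / \<gamma> ^ (4 * i) \<in> S} = c"
  shows "dsrg (carrier \<Gamma>) (arc S)
    (CARD('a) * l) (card S * l) (card S * c) ((card S - 1) * c) (card S * c)"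
proof -
  have "\<not> arc S v v" if "v \<in> carrier \<Gamma>" for v
    using that assms(1) by (auto simp: carrier_semidirect_grp arc_iff)
  moreover have "finite (carrier \<Gamma>)" "card (carrier \<Gamma>) = CARD('a) * l"
    by (simp_all add: carrier_semidirect_grp card_cartesian_product)
  ultimately show ?thesis
    using card_common_neighbours[OF _ _ assms]
    by (auto simp: dsrg_def card_out_neighbours card_in_neighbours)
qed

end

theorem mainTheorem5:
  fixes \<gamma> :: "'a::{field,finite}" and a :: nat
  assumes "a > 0"
    and "CARD('a) = 1 + 16 * a ^ 2"
    and "primitive_element \<gamma>"
  defines "q \<equiv> CARD('a)"
  defines "l \<equiv> (q - 1) div 4"
  defines "G \<equiv> semidirect_grp \<gamma> l"
  defines "S \<equiv> {-1 + x | x. x \<in> cyclotomic_class \<gamma> 4 2}"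
  defines "E \<equiv> S \<times> {0..<l}"
  shows "dsrg (carrier G) (cayley_arc G E)
           (q * (q - 1) div 4) (((q - 1) div 4) ^ 2) (((q - 1) div 8) ^ 2)
           (((q - 1) div 8) ^ 2 - (q - 1) div 16) (((q - 1) div 8) ^ 2)"
proof -
  have l: "l = 4 * a ^ 2"
    using assms(2) by (simp add: q_def l_def)
  interpret quartic_cyclotomy \<gamma> l
    using assms(2,3) l by unfold_locales auto
  interpret semidirect_field \<gamma> l
    using f_pos gamma_power_order by unfold_locales (simp_all add: card_field)
  have mem_S_iff: "s \<in> S \<longleftrightarrow> s + 1 \<in> D 2" for s
    by (auto simp: S_def intro: exI[of _ "s + 1"])
  have "S = (\<lambda>x. - 1 + x) ` D 2"
    by (auto simp: S_def)
  then have card_S: "card S = l"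
    by (simp add: card_image card_cyclotomic_class)
  have "0 \<notin> S"
    using one_mem_cyclotomic_class by (auto simp: mem_S_iff mem_cyclotomic_class_iff cong_def)
  have quotients: "card {i \<in> {0..<l}. t / \<gamma> ^ (4 * i) \<in> S} = a ^ 2" if "t \<noteq> 0" for t
    using that card_quotients_add_one_mem[of t "dlog t" 2] cyclotomic_number_2_eq[OF l]
    by (simp add: mem_S_iff mem_cyclotomic_class_iff)
  have "dsrg (carrier G) (cayley_arc G E) (q * l) (l * l) (l * a ^ 2) ((l - 1) * a ^ 2) (l * a ^ 2)"
    using dsrg_cayley_arc[OF \<open>0 \<notin> S\<close> quotients] by (simp add: card_S G_def E_def q_def)
  moreover have "q * (q - 1) div 4 = q * l" "((q - 1) div 4) ^ 2 = l * l"
      "((q - 1) div 8) ^ 2 = l * a ^ 2" "(q - 1) div 16 = a ^ 2"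
    using assms(2) by (simp_all add: q_def l power2_eq_square)
  ultimately show ?thesis
    by (simp only: diff_mult_distrib mult_1)
qed

end
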